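(* (Singularity resolution and symmetric bounce, Alesci-Assanioussi-Lewandowski-Makinen Hamiltonian with dust.) Let $\beta,\kappa>0$ and let $(V(\tau),b(\tau))$, $V>0$, be a solution on an interval of $$\frac{dV}{d\tau}=\frac{2V^{2/3}\sin(2b)}{\beta},\qquad \frac{db}{d\tau}=-\frac{2\sin^2(b)}{3\beta V^{1/3}}.$$ Then $\mathcal E=\dfrac{8V^{1/3}\sin^2(b)}{\beta^2\kappa}$ is constant along the solution. If $\mathcal E>0$, then with $V_c=\dfrac{\mathcal E^3\beta^6\kappa^3}{512}>0$ one has $V(\tau)\ge V_c$ for all $\tau$, and $dV/d\tau=0$ at a time $\tau$ if and only if $V(\tau)=V_c$; for the solutions with $V(0)=V_c$ and $b(0)\in[-\pi/2,\pi/2]$ one has $b(0)=\pm\frac{\pi}{2}$. The two solutions $V(\tau)$ corresponding to $b(0)=\frac\pi2$ and $b(0)=-\frac\pi2$ coincide, and the bounce is symmetric: $V(-\tau)=V(\tau)$.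
   Context: $V$ is the 3-volume per lattice vertex, $b$ the holonomy angle, $\beta$ the Barbero-Immirzi parameter, $\kappa=16\pi G$, and $\mathcal E=\rho V$ the conserved dust energy per vertex. The big-bang singularity would correspond to $V\to0$. Solutions with bounce time set to $\tau=0$ are taken on intervals symmetric about $0$. *)

theory Defs
  imports "HOL-Analysis.Analysis"
begin

(* I may be open, closed, half-open or unbounded; at an endpoint belonging to I the
   derivative "at t within I" is one-sided.  The requirement of a nonempty interior excludes
   one-point intervals, for which every number is a derivative within I. *)
definition alm_dust_solution ::
    "real \<Rightarrow> real set \<Rightarrow> (real \<Rightarrow> real) \<Rightarrow> (real \<Rightarrow> real) \<Rightarrow> bool" where
  "alm_dust_solution \<beta> I V b \<longleftrightarrow>
     is_interval I \<and> interior I \<noteq> {} \<and>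
     (\<forall>\<tau>\<in>I. 0 < V \<tau> \<and>
        (V has_real_derivative 2 * V \<tau> powr (2/3) * sin (2 * b \<tau>) / \<beta>) (at \<tau> within I) \<and>
        (b has_real_derivative - (2 * (sin (b \<tau>))\<^sup>2 / (3 * \<beta> * V \<tau> powr (1/3))))
          (at \<tau> within I))"

definition dust_energy :: "real \<Rightarrow> real \<Rightarrow> real \<Rightarrow> real \<Rightarrow> real" where
  "dust_energy \<beta> \<kappa> v \<theta> = 8 * v powr (1/3) * (sin \<theta>)\<^sup>2 / (\<beta>\<^sup>2 * \<kappa>)"

definition critical_volume :: "real \<Rightarrow> real \<Rightarrow> real \<Rightarrow> real" where
  "critical_volume \<beta> \<kappa> \<E> = \<E> ^ 3 * \<beta> ^ 6 * \<kappa> ^ 3 / 512"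

end

(* In terms of w = V^(1/3) the system reads w' = 2 sin(2b)/(3 beta), b' = -2 sin^2(b)/(3 beta w),
   which conserves c = w sin^2(b).  If c > 0 then u = cot b is globally defined, w = c (1 + u^2),
   and (1 + u^2) u' is the constant k = 2/(3 beta c); hence u + u^3/3 - k t is a second constant
   of motion.  It vanishes when the bounce is at t = 0, and strict monotonicity of u + u^3/3 then
   makes u an odd function of time, so that w is even and depends only on c. *)

theory Submission
  imports Defs
begin

section \<open>Cube roots, the cubic u + u^3/3, and derivatives within an interval\<close>

lemma cube_powr_third:
  fixes x :: real
  assumes "0 < x"
  shows "(x powr (1/3)) ^ 3 = x" "(x ^ 3) powr (1/3) = x"
proof -
  have "(x powr (1/3)) ^ 3 = (x powr (1/3)) powr 3"
    using assms by simp
  then show "(x powr (1/3)) ^ 3 = x"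
    using assms by (simp add: powr_powr)
  have "(x ^ 3) powr (1/3) = (x powr 3) powr (1/3)"
    using assms by simp
  then show "(x ^ 3) powr (1/3) = x"
    using assms by (simp only: powr_powr) simp
qed

text \<open>Supplies injectivity: the cotangent can be compared through the implicit equation of
  motion without inverting the cubic.\<close>

lemma strict_mono_add_cube_third: "strict_mono (\<lambda>u::real. u + u ^ 3 / 3)"
proof (rule strict_monoI)
  fix x y :: real
  assume "x < y"
  moreover have "x ^ 3 \<le> y ^ 3"
    using \<open>x < y\<close> by (simp add: power_mono_odd)
  ultimately show "x + x ^ 3 / 3 < y + y ^ 3 / 3"
    by simp
qed

lemma add_cube_third_derivative:
  fixes u :: "real \<Rightarrow> real"
  assumes "(u has_real_derivative D) (at t within S)"
  shows "((\<lambda>t. u t + u t ^ 3 / 3 - k * t) has_real_derivative (1 + (u t)\<^sup>2) * D - k) (at t within S)"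
  using assms by (auto intro!: derivative_eq_intros simp: algebra_simps)

text \<open>A connected set with more than one point has only limit points, so limits of difference
  quotients are unique, endpoints included. Hence V can have derivative 0 only where the right-hand
  side of its equation vanishes.\<close>

lemma real_derivative_unique_within_interval:
  fixes f :: "real \<Rightarrow> real"
  assumes "is_interval I" "interior I \<noteq> {}" "x \<in> I"
    and "(f has_real_derivative d) (at x within I)"
    and "(f has_real_derivative e) (at x within I)"
  shows "d = e"
proof -
  have "\<not> I \<subseteq> {x}"
    using assms(2) interior_mono[of I "{x}"] by auto
  then have "x islimpt I"
    using assms by (intro connected_imp_perfect) (auto simp: is_interval_connected)
  then have "at x within I \<noteq> bot"
    by (simp add: trivial_limit_within)
  then show ?thesis
    using assms(4,5) by (meson has_field_derivative_iff tendsto_unique)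
qed

lemma one_plus_cot_squared:
  fixes x :: real
  assumes "sin x \<noteq> 0"
  shows "1 + (cot x)\<^sup>2 = 1 / (sin x)\<^sup>2"
  using assms by (simp add: cot_def field_simps)

lemma dust_energy_eq_iff:
  assumes "0 < \<beta>" "0 < \<kappa>"
  shows "dust_energy \<beta> \<kappa> v \<theta> = \<E> \<longleftrightarrow>
    v powr (1/3) * (sin \<theta>)\<^sup>2 = \<E> * \<beta>\<^sup>2 * \<kappa> / 8"
  using assms by (auto simp: dust_energy_def field_simps)

text \<open>Since 512 = 8^3, the critical volume is the cube of the value that
  \<open>dust_energy_eq_iff\<close> assigns to w sin^2(b).\<close>

lemma critical_volume_eq_cube: "critical_volume \<beta> \<kappa> \<E> = (\<E> * \<beta>\<^sup>2 * \<kappa> / 8) ^ 3"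
  by (simp add: critical_volume_def power_mult_distrib power_divide)

section \<open>The system in terms of the cube root of the volume\<close>

context
  fixes \<beta> :: real and I :: "real set" and V b :: "real \<Rightarrow> real"
  assumes beta: "0 < \<beta>" and sol: "alm_dust_solution \<beta> I V b"
begin

lemma solution_interval: "is_interval I" "interior I \<noteq> {}"
  using sol by (auto simp: alm_dust_solution_def)

lemma volume_pos: "t \<in> I \<Longrightarrow> 0 < V t"
  using sol by (auto simp: alm_dust_solution_def)

lemma volume_derivative:
  "t \<in> I \<Longrightarrow> (V has_real_derivative 2 * V t powr (2/3) * sin (2 * b t) / \<beta>) (at t within I)"
  using sol by (auto simp: alm_dust_solution_def)

lemma angle_derivative:
  "t \<in> I \<Longrightarrow> (b has_real_derivative - (2 * (sin (b t))\<^sup>2 / (3 * \<beta> * V t powr (1/3))))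
    (at t within I)"
  using sol by (auto simp: alm_dust_solution_def)

text \<open>The chain rule contributes the exponent -2/3, which cancels the 2/3 in the equation for
  V.\<close>

lemma cube_root_volume_derivative:
  assumes "t \<in> I"
  shows "((\<lambda>t. V t powr (1/3)) has_real_derivative 2 * sin (2 * b t) / (3 * \<beta>)) (at t within I)"
proof -
  have pos: "0 < V t"
    using assms by (rule volume_pos)
  have "((\<lambda>x. x powr (1/3)) has_real_derivative 1/3 * V t powr (1/3 - 1)) (at (V t))"
    using pos by (rule has_real_derivative_powr)
  from DERIV_chain2[OF this volume_derivative[OF assms]]
  have "((\<lambda>t. V t powr (1/3)) has_real_derivative
      1/3 * V t powr (1/3 - 1) * (2 * V t powr (2/3) * sin (2 * b t) / \<beta>)) (at t within I)" .
  moreover have "V t powr (1/3 - 1) * V t powr (2/3) = 1"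
    using pos by (simp flip: powr_add)
  then have "1/3 * V t powr (1/3 - 1) * (2 * V t powr (2/3) * sin (2 * b t) / \<beta>) =
      2 * sin (2 * b t) / (3 * \<beta>)"
    using beta by (simp add: field_simps)
  ultimately show ?thesis
    by (simp only:)
qed

text \<open>By the product rule the two terms are 4 sin^3(b) cos(b) / (3 \<beta>) and its
  negative.\<close>

lemma conserved_quantity: "\<exists>c. \<forall>t\<in>I. V t powr (1/3) * (sin (b t))\<^sup>2 = c"
proof -
  have "((\<lambda>t. V t powr (1/3) * (sin (b t))\<^sup>2) has_real_derivative 0) (at t within I)"
    if "t \<in> I" for t
  proof -
    note [derivative_intros] =
      cube_root_volume_derivative[OF that] angle_derivative[OF that]
    show ?thesis
      using beta volume_pos[OF that]
      by (auto intro!: derivative_eq_intros simp: sin_double divide_simps)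
  qed
  then show ?thesis
    using has_field_derivative_zero_constant[OF is_interval_convex[OF solution_interval(1)]]
    by blast
qed

section \<open>Solutions with a positive conserved value c\<close>

context
  fixes c :: real
  assumes c_pos: "0 < c"
    and conserved: "\<And>t. t \<in> I \<Longrightarrow> V t powr (1/3) * (sin (b t))\<^sup>2 = c"
begin

text \<open>A positive product w sin^2(b) keeps b away from the multiples of pi, so cot b is
  differentiable throughout I.\<close>

lemma sin_angle_nonzero: "t \<in> I \<Longrightarrow> sin (b t) \<noteq> 0"
  using conserved c_pos by fastforce

lemma cube_root_volume_eq: "t \<in> I \<Longrightarrow> V t powr (1/3) = c * (1 + (cot (b t))\<^sup>2)"
  using conserved sin_angle_nonzero by (simp add: one_plus_cot_squared field_simps)

lemma volume_eq:
  assumes "t \<in> I"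
  shows "V t = (c * (1 + (cot (b t))\<^sup>2)) ^ 3"
  using cube_root_volume_eq[OF assms] cube_powr_third(1)[OF volume_pos[OF assms]] by simp

text \<open>The summand cot^2(b) is nonnegative, and cubing is monotone on nonnegative numbers. This
  bound excludes the singularity.\<close>

lemma volume_ge:
  assumes "t \<in> I"
  shows "c ^ 3 \<le> V t"
  using volume_eq[OF assms] c_pos
  by (auto intro!: power_mono simp: distrib_left)

lemma volume_eq_iff:
  assumes "t \<in> I"
  shows "V t = c ^ 3 \<longleftrightarrow> cos (b t) = 0"
proof -
  have "V t = c ^ 3 \<longleftrightarrow> c * (1 + (cot (b t))\<^sup>2) = c"
    unfolding volume_eq[OF assms] using c_pos by (intro power_eq_iff_eq_base) auto
  also have "\<dots> \<longleftrightarrow> cos (b t) = 0"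
    using c_pos sin_angle_nonzero[OF assms] by (auto simp: distrib_left cot_def)
  finally show ?thesis .
qed

text \<open>In sin(2b) = 2 sin(b) cos(b) only the cosine can vanish, and its zeros are exactly where
  V attains the lower bound.\<close>

lemma volume_stationary_iff:
  assumes "t \<in> I"
  shows "(V has_real_derivative 0) (at t within I) \<longleftrightarrow> V t = c ^ 3"
proof -
  have "(V has_real_derivative 0) (at t within I) \<longleftrightarrow>
      2 * V t powr (2/3) * sin (2 * b t) / \<beta> = 0"
    using real_derivative_unique_within_interval[OF solution_interval assms volume_derivative[OF assms], of 0]
      volume_derivative[OF assms] by metis
  also have "\<dots> \<longleftrightarrow> cos (b t) = 0"
    using beta volume_pos[OF assms] sin_angle_nonzero[OF assms] by (simp add: sin_double)
  finally show ?thesis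
    using volume_eq_iff[OF assms] by simp
qed

text \<open>The factor -1/sin^2(b) from the cotangent cancels the sin^2(b) in the equation for b; w
  is then replaced by its expression in cot b, leaving an autonomous equation for u.\<close>

lemma cot_angle_derivative:
  assumes "t \<in> I"
  shows "((\<lambda>t. cot (b t)) has_real_derivative 2 / (3 * \<beta> * c * (1 + (cot (b t))\<^sup>2))) (at t within I)"
proof -
  have s: "sin (b t) \<noteq> 0"
    using assms by (rule sin_angle_nonzero)
  have "((\<lambda>t. cot (b t)) has_real_derivative - inverse ((sin (b t))\<^sup>2) *
      - (2 * (sin (b t))\<^sup>2 / (3 * \<beta> * V t powr (1/3)))) (at t within I)"
    using DERIV_chain2[OF DERIV_cot[OF s] angle_derivative[OF assms]] .
  then show ?thesis
    using s by (simp add: cube_root_volume_eq[OF assms] field_simps)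
qed

text \<open>Separation of variables integrates (1 + u^2) u' = 2 / (3 \<beta> c).\<close>

lemma cot_angle_eq:
  assumes "0 \<in> I" "V 0 = c ^ 3" "t \<in> I"
  shows "cot (b t) + cot (b t) ^ 3 / 3 = 2 / (3 * \<beta> * c) * t"
proof -
  let ?f = "\<lambda>t. cot (b t) + cot (b t) ^ 3 / 3 - 2 / (3 * \<beta> * c) * t"
  have "(?f has_real_derivative 0) (at t within I)" if "t \<in> I" for t
  proof -
    have "m * (2 / (3 * \<beta> * c * m)) = 2 / (3 * \<beta> * c)" if "m \<noteq> 0" for m :: real
      using that by simp
    moreover have "1 + (cot (b t))\<^sup>2 \<noteq> 0"
      using sin_angle_nonzero[OF that] by (simp add: one_plus_cot_squared)
    ultimately have "(1 + (cot (b t))\<^sup>2) * (2 / (3 * \<beta> * c * (1 + (cot (b t))\<^sup>2))) = 2 / (3 * \<beta> * c)"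
      by blast
    moreover have "(?f has_real_derivative
        (1 + (cot (b t))\<^sup>2) * (2 / (3 * \<beta> * c * (1 + (cot (b t))\<^sup>2))) - 2 / (3 * \<beta> * c))
        (at t within I)"
      using cot_angle_derivative[OF that] by (rule add_cube_third_derivative)
    ultimately show ?thesis
      by simp
  qed
  then obtain C where C: "\<And>t. t \<in> I \<Longrightarrow> ?f t = C"
    using has_field_derivative_zero_constant[OF is_interval_convex[OF solution_interval(1)], of ?f]
    by blast
  \<comment> \<open>The bounce at time 0 gives u = 0 there, which fixes the constant of
    integration.\<close>
  have "cos (b 0) = 0"
    using assms volume_eq_iff by simp
  then have "C = 0"
    using C[OF assms(1)] by (simp add: cot_def)
  then show ?thesis
    using C[OF assms(3)] by simp
qed

lemma volume_symmetric:
  assumes "0 \<in> I" "V 0 = c ^ 3" "t \<in> I" "- t \<in> I"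
  shows "V (- t) = V t"
proof -
  let ?g = "\<lambda>u::real. u + u ^ 3 / 3"
  \<comment> \<open>The right-hand side of \<open>cot_angle_eq\<close> is odd in time and
    \<open>?g\<close> is odd in u.\<close>
  have "?g (cot (b (- t))) = ?g (- cot (b t))"
    using cot_angle_eq[OF assms(1,2,3)] cot_angle_eq[OF assms(1,2,4)] by simp
  then have "cot (b (- t)) = - cot (b t)"
    using strict_mono_eq[OF strict_mono_add_cube_third] by blast
  then show ?thesis
    by (simp add: volume_eq assms)
qed

end

end

section \<open>Comparison of two solutions that bounce at time 0\<close>

lemma volume_eq_of_bounce:
  assumes "0 < \<beta>" "0 < c"
    and sol1: "alm_dust_solution \<beta> I V b" and cons1: "\<And>t. t \<in> I \<Longrightarrow> V t powr (1/3) * (sin (b t))\<^sup>2 = c"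
    and sol2: "alm_dust_solution \<beta> J W d" and cons2: "\<And>t. t \<in> J \<Longrightarrow> W t powr (1/3) * (sin (d t))\<^sup>2 = c"
    and "0 \<in> I" "0 \<in> J" "V 0 = c ^ 3" "W 0 = c ^ 3" "t \<in> I" "t \<in> J"
  shows "V t = W t"
proof -
  let ?g = "\<lambda>u::real. u + u ^ 3 / 3"
  \<comment> \<open>Both sides equal 2 t / (3 \<beta> c), an expression shared by all solutions with
    the same c that bounce at time 0.\<close>
  have "?g (cot (b t)) = ?g (cot (d t))"
    using assms cot_angle_eq[OF assms(1) sol1 assms(2) cons1]
      cot_angle_eq[OF assms(1) sol2 assms(2) cons2] by simp
  then have "cot (b t) = cot (d t)"
    using strict_mono_eq[OF strict_mono_add_cube_third] by blast
  then show ?thesis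
    using assms volume_eq[OF assms(1) sol1 assms(2) cons1]
      volume_eq[OF assms(1) sol2 assms(2) cons2] by simp
qed

text \<open>Zero lies between any point and its reflection. This places the initial data of the two
  compared solutions inside their intervals.\<close>

lemma symmetric_interval_contains_zero:
  fixes I :: "real set"
  assumes "is_interval I" "interior I \<noteq> {}" "\<forall>t\<in>I. - t \<in> I"
  shows "0 \<in> I"
proof -
  obtain t where "t \<in> I"
    using assms(2) interior_subset by blast
  then have "- \<bar>t\<bar> \<in> I" "\<bar>t\<bar> \<in> I"
    using assms(3) by (auto simp: abs_if)
  then show ?thesis
    using mem_is_interval_1_I[OF assms(1), of "- \<bar>t\<bar>" "\<bar>t\<bar>" 0] by simp
qed

text \<open>The conserved quantity is evaluated at time 0, where w = c and sin^2(b) = 1. Thus the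
  initial data alone determine the energy.\<close>

lemma conserved_from_bounce:
  assumes "0 < \<beta>" "alm_dust_solution \<beta> I V b" "0 < c"
    and "0 \<in> I" "V 0 = c ^ 3" "(sin (b 0))\<^sup>2 = 1" "t \<in> I"
  shows "V t powr (1/3) * (sin (b t))\<^sup>2 = c"
  using conserved_quantity[OF assms(1,2)] assms cube_powr_third(2)[of c] by force

text \<open>The cosine is positive strictly between -pi/2 and pi/2, leaving only the
  endpoints.\<close>

lemma cos_zero_principal:
  fixes x :: real
  assumes "x \<in> {- (pi/2)..pi/2}" "cos x = 0"
  shows "x = pi/2 \<or> x = - (pi/2)"
  using assms cos_gt_zero_pi[of x] by force

section \<open>Translation from c to the energy and the critical volume\<close>

theorem mainTheorem6:
  fixes \<beta> \<kappa> :: real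
  assumes "0 < \<beta>" and "0 < \<kappa>"
  shows
    "(\<forall>I V b. alm_dust_solution \<beta> I V b \<longrightarrow>
        (\<exists>\<E>. \<forall>\<tau>\<in>I. dust_energy \<beta> \<kappa> (V \<tau>) (b \<tau>) = \<E>) \<and>
        (\<forall>\<E>>0. (\<forall>\<tau>\<in>I. dust_energy \<beta> \<kappa> (V \<tau>) (b \<tau>) = \<E>) \<longrightarrow>
           0 < critical_volume \<beta> \<kappa> \<E> \<and>
           (\<forall>\<tau>\<in>I. critical_volume \<beta> \<kappa> \<E> \<le> V \<tau>) \<and>
           (\<forall>\<tau>\<in>I. (V has_real_derivative 0) (at \<tau> within I) \<longleftrightarrow>
                   V \<tau> = critical_volume \<beta> \<kappa> \<E>) \<and>
           (0 \<in> I \<and> V 0 = critical_volume \<beta> \<kappa> \<E> \<and> b 0 \<in> {- (pi/2)..pi/2} \<longrightarrow>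
              (b 0 = pi/2 \<or> b 0 = - (pi/2)) \<and>
              ((\<forall>\<tau>\<in>I. - \<tau> \<in> I) \<longrightarrow> (\<forall>\<tau>\<in>I. V (- \<tau>) = V \<tau>))))) \<and>
     (\<forall>\<E>>0. \<forall>I\<^sub>1 V\<^sub>1 b\<^sub>1 I\<^sub>2 V\<^sub>2 b\<^sub>2.
        alm_dust_solution \<beta> I\<^sub>1 V\<^sub>1 b\<^sub>1 \<and> (\<forall>\<tau>\<in>I\<^sub>1. - \<tau> \<in> I\<^sub>1) \<and>
        V\<^sub>1 0 = critical_volume \<beta> \<kappa> \<E> \<and> b\<^sub>1 0 = pi/2 \<and>
        alm_dust_solution \<beta> I\<^sub>2 V\<^sub>2 b\<^sub>2 \<and> (\<forall>\<tau>\<in>I\<^sub>2. - \<tau> \<in> I\<^sub>2) \<and>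
        V\<^sub>2 0 = critical_volume \<beta> \<kappa> \<E> \<and> b\<^sub>2 0 = - (pi/2) \<longrightarrow>
        (\<forall>\<tau>\<in>I\<^sub>1 \<inter> I\<^sub>2. V\<^sub>1 \<tau> = V\<^sub>2 \<tau>))"
proof (intro conjI allI impI)
  fix I V b
  assume sol: "alm_dust_solution \<beta> I V b"
  show "\<exists>\<E>. \<forall>\<tau>\<in>I. dust_energy \<beta> \<kappa> (V \<tau>) (b \<tau>) = \<E>"
  proof -
    obtain c where "\<forall>t\<in>I. V t powr (1/3) * (sin (b t))\<^sup>2 = c"
      using conserved_quantity[OF assms(1) sol] by blast
    then have "\<forall>t\<in>I. dust_energy \<beta> \<kappa> (V t) (b t) = 8 * c / (\<beta>\<^sup>2 * \<kappa>)"
      by (auto simp: dust_energy_def)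
    then show ?thesis ..
  qed
  fix \<E> :: real
  assume E: "0 < \<E>" "\<forall>\<tau>\<in>I. dust_energy \<beta> \<kappa> (V \<tau>) (b \<tau>) = \<E>"
  \<comment> \<open>The value of w sin^2(b), obtained by solving the energy formula for this
    product.\<close>
  define c where "c = \<E> * \<beta>\<^sup>2 * \<kappa> / 8"
  have c: "0 < c"
    using E assms by (simp add: c_def)
  have cons: "V t powr (1/3) * (sin (b t))\<^sup>2 = c" if "t \<in> I" for t
    using E(2) that assms by (simp add: dust_energy_eq_iff c_def)
  have crit: "critical_volume \<beta> \<kappa> \<E> = c ^ 3"
    by (simp add: critical_volume_eq_cube c_def)
  show "0 < critical_volume \<beta> \<kappa> \<E>"
    using c by (simp add: crit)
  show "\<forall>\<tau>\<in>I. critical_volume \<beta> \<kappa> \<E> \<le> V \<tau>"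
    using volume_ge[OF assms(1) sol c cons] by (simp add: crit)
  show "\<forall>\<tau>\<in>I. (V has_real_derivative 0) (at \<tau> within I) \<longleftrightarrow> V \<tau> = critical_volume \<beta> \<kappa> \<E>"
    using volume_stationary_iff[OF assms(1) sol c cons] by (simp add: crit)
  assume bounce: "0 \<in> I \<and> V 0 = critical_volume \<beta> \<kappa> \<E> \<and> b 0 \<in> {- (pi/2)..pi/2}"
  then have "cos (b 0) = 0"
    using volume_eq_iff[OF assms(1) sol c cons, of 0] by (simp add: crit)
  then show "b 0 = pi/2 \<or> b 0 = - (pi/2)"
    using bounce cos_zero_principal by blast
  assume "\<forall>\<tau>\<in>I. - \<tau> \<in> I"
  then show "\<forall>\<tau>\<in>I. V (- \<tau>) = V \<tau>"
    using bounce volume_symmetric[OF assms(1) sol c cons] by (simp add: crit)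
next
  fix \<E> :: real and I\<^sub>1 V\<^sub>1 b\<^sub>1 I\<^sub>2 V\<^sub>2 b\<^sub>2
  assume E: "0 < \<E>"
    and h: "alm_dust_solution \<beta> I\<^sub>1 V\<^sub>1 b\<^sub>1 \<and> (\<forall>\<tau>\<in>I\<^sub>1. - \<tau> \<in> I\<^sub>1) \<and>
        V\<^sub>1 0 = critical_volume \<beta> \<kappa> \<E> \<and> b\<^sub>1 0 = pi/2 \<and>
        alm_dust_solution \<beta> I\<^sub>2 V\<^sub>2 b\<^sub>2 \<and> (\<forall>\<tau>\<in>I\<^sub>2. - \<tau> \<in> I\<^sub>2) \<and>
        V\<^sub>2 0 = critical_volume \<beta> \<kappa> \<E> \<and> b\<^sub>2 0 = - (pi/2)"
  define c where "c = \<E> * \<beta>\<^sup>2 * \<kappa> / 8"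
  have c: "0 < c"
    using E assms by (simp add: c_def)
  have crit: "critical_volume \<beta> \<kappa> \<E> = c ^ 3"
    by (simp add: critical_volume_eq_cube c_def)
  have sol1: "alm_dust_solution \<beta> I\<^sub>1 V\<^sub>1 b\<^sub>1" and sol2: "alm_dust_solution \<beta> I\<^sub>2 V\<^sub>2 b\<^sub>2"
    and V0: "V\<^sub>1 0 = c ^ 3" "V\<^sub>2 0 = c ^ 3"
    and b0: "b\<^sub>1 0 = pi/2" "b\<^sub>2 0 = - (pi/2)"
    unfolding crit[symmetric] using h by blast+
  \<comment> \<open>Squaring removes the sign that distinguishes the two initial angles, so both
    solutions have the same c.\<close>
  have sin0: "(sin (b\<^sub>1 0))\<^sup>2 = 1" "(sin (b\<^sub>2 0))\<^sup>2 = 1"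
    unfolding b0 by simp_all
  have zero: "0 \<in> I\<^sub>1" "0 \<in> I\<^sub>2"
    using h solution_interval[OF assms(1) sol1] solution_interval[OF assms(1) sol2]
    by (auto intro!: symmetric_interval_contains_zero)
  note cons1 = conserved_from_bounce[OF assms(1) sol1 c zero(1) V0(1) sin0(1)]
  note cons2 = conserved_from_bounce[OF assms(1) sol2 c zero(2) V0(2) sin0(2)]
  show "\<forall>\<tau>\<in>I\<^sub>1 \<inter> I\<^sub>2. V\<^sub>1 \<tau> = V\<^sub>2 \<tau>"
    using volume_eq_of_bounce[OF assms(1) c sol1 cons1 sol2 cons2 zero V0] by blast
qed

end
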